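(* Let $S$ be an Arf numerical semigroup with embedding dimension $e$ satisfying at least one of the following: (1) the multiplicity of $S$ is at most $5$; (2) the conductor of $S$ is a multiple of the multiplicity of $S$. Then there exists a row-factorization matrix $A$ of the Frobenius number $F(S)$ such that $\det A = (-1)^{e+1}F(S)$.
   Context: $\mathbb{N}_0$ denotes the non-negative integers. A numerical semigroup is a subset $S\subseteq\mathbb{N}_0$ containing $0$, closed under addition, with finite complement in $\mathbb{N}_0$. Its multiplicity is its smallest nonzero element; its Frobenius number $F(S)$ is the greatest integer not in $S$ (so $F(\mathbb{N}_0)=-1$); its conductor is $F(S)+1$. Every numerical semigroup has a unique minimal generating set $\{n_1<n_2<\dots<n_e\}$, and $e$ is its embedding dimension. $S$ is Arf if $s_2+s_3-s_1\in S$ for all $s_1\le s_2\le s_3$ in $S$. An integer $z$ is a pseudo-Frobenius number of $S$ if $z\notin S$ and $z+s\in S$ for all nonzero $s\in S$; $F(S)$ is one of them. A row-factorization matrix (RF-matrix) of a pseudo-Frobenius number $f$ is an $e\times e$ integer matrix $[a_{ij}]$ with $a_{ii}=-1$, $a_{ij}\in\mathbb{N}_0$ for $i\ne j$, and $f=\sum_{j=1}^e a_{ij}n_j$ for each $i\in\{1,\dots,e\}$. *)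

theory Defs
  imports Main "Jordan_Normal_Form.Determinant"
begin

definition additive_submonoid :: "nat set \<Rightarrow> bool" where
  "additive_submonoid M \<longleftrightarrow> 0 \<in> M \<and> (\<forall>x\<in>M. \<forall>y\<in>M. x + y \<in> M)"

definition numerical_semigroup :: "nat set \<Rightarrow> bool" where
  "numerical_semigroup S \<longleftrightarrow> additive_submonoid S \<and> finite (- S)"

definition multiplicity_of :: "nat set \<Rightarrow> nat" where
  "multiplicity_of S = (LEAST s. s \<in> S \<and> s \<noteq> 0)"

text \<open>The Frobenius number is an integer, so that it is \<open>-1\<close> for \<open>S = UNIV\<close>.\<close>

definition frobenius_number :: "nat set \<Rightarrow> int" where
  "frobenius_number S = (GREATEST z. z \<notin> int ` S)"

definition conductor :: "nat set \<Rightarrow> int" where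
  "conductor S = frobenius_number S + 1"

text \<open>Minimality is with respect to inclusion; for a numerical semigroup there is exactly
  one such set.\<close>

definition is_minimal_generating_set :: "nat set \<Rightarrow> nat set \<Rightarrow> bool" where
  "is_minimal_generating_set S G \<longleftrightarrow>
     additive_submonoid hull G = S \<and> (\<forall>H. H \<subset> G \<longrightarrow> additive_submonoid hull H \<noteq> S)"

definition minimal_generators :: "nat set \<Rightarrow> nat set" where
  "minimal_generators S = (THE G. is_minimal_generating_set S G)"

definition embedding_dimension :: "nat set \<Rightarrow> nat" where
  "embedding_dimension S = card (minimal_generators S)"

text \<open>Indices start at \<open>0\<close>: \<open>min_gen S j\<close> is the generator \<open>n\<^sub>j\<^sub>+\<^sub>1\<close> of
  \<open>n\<^sub>1 < \<dots> < n\<^sub>e\<close>.\<close>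

definition min_gen :: "nat set \<Rightarrow> nat \<Rightarrow> nat" where
  "min_gen S j = sorted_list_of_set (minimal_generators S) ! j"

definition Arf :: "nat set \<Rightarrow> bool" where
  "Arf S \<longleftrightarrow> (\<forall>s1\<in>S. \<forall>s2\<in>S. \<forall>s3\<in>S. s1 \<le> s2 \<and> s2 \<le> s3 \<longrightarrow> s2 + s3 - s1 \<in> S)"

definition pseudo_frobenius :: "nat set \<Rightarrow> int \<Rightarrow> bool" where
  "pseudo_frobenius S z \<longleftrightarrow>
     z \<notin> int ` S \<and> (\<forall>s\<in>S. s \<noteq> 0 \<longrightarrow> z + int s \<in> int ` S)"

definition RF_matrix :: "nat set \<Rightarrow> int \<Rightarrow> int mat \<Rightarrow> bool" where
  "RF_matrix S f A \<longleftrightarrow>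
     pseudo_frobenius S f \<and>
     A \<in> carrier_mat (embedding_dimension S) (embedding_dimension S) \<and>
     (\<forall>i < embedding_dimension S.
        A $$ (i, i) = -1 \<and>
        (\<forall>j < embedding_dimension S. i \<noteq> j \<longrightarrow> 0 \<le> A $$ (i, j)) \<and>
        f = (\<Sum>j < embedding_dimension S. A $$ (i, j) * int (min_gen S j)))"

end

theory Submission imports Defs "HOL-Number_Theory.Cong"
begin

text \<open>
  Write \<open>m\<close> for the multiplicity, \<open>f\<close> for the Frobenius number and \<open>w x\<close> for the Apery element
  of the residue class of \<open>x\<close>, i.e. the least element of the semigroup in that class modulo
  \<open>m\<close>.  In an Arf semigroup no nonzero Apery element splits as \<open>a + b\<close> with nonzero \<open>a\<close>, \<open>b\<close>,
  because \<open>a + b - m\<close> would be a smaller element of the same class.  Hence the minimal generators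
  are exactly \<open>m\<close> and the \<open>m - 1\<close> nonzero Apery elements (\<open>bij_betw_minimal_generators\<close>), and they
  may be listed in any convenient order, since permuting rows and columns simultaneously
  preserves the determinant (\<open>RF_matrix_of_enumeration\<close>).

  Suppose first that \<open>f\<close> is coprime to \<open>m\<close> (\<open>RF_matrix_coprime\<close>).  Then the classes of
  \<open>0, f, 2f, \<dots>, (m-1)f\<close> are all the classes, and the generators are listed as
  \<open>m, w f, w (2f), \<dots>\<close>.  For \<open>r > 0\<close> the number \<open>w (rf) + f\<close> exceeds \<open>f\<close>, so it lies in the
  semigroup, and being in the class of \<open>(r+1)f\<close> it equals \<open>w ((r+1)f)\<close> plus a nonnegative multiple
  of \<open>m\<close>; moreover \<open>m + f = w f\<close>.  These relations are the rows of a matrix with diagonal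
  \<open>-1\<close>, superdiagonal \<open>1\<close> and further nonzero entries only in the first column, whose
  determinant comes out as \<open>(-1)^(m+1) f\<close> (\<open>det_cyclic_RF\<close>).

  A conductor divisible by \<open>m\<close> means \<open>f \<equiv> -1\<close> modulo \<open>m\<close>, so \<open>f\<close> is coprime to \<open>m\<close>.  As
  \<open>m\<close> divides \<open>f\<close> only if \<open>m = 1\<close>, coprimality holds for every \<open>m \<le> 5\<close> as well, except when
  \<open>m = 4\<close> and \<open>f = 4k + 2\<close>.  In that case the Arf property determines the
  semigroup: its generators are \<open>4, f + 1, f + 3, f + 4\<close>, and an explicit matrix works
  (\<open>RF_matrix_quartic\<close>).
\<close>

section \<open>Determinants\<close>

lemma det_permute_simultaneously:
  fixes P :: "'a :: comm_ring_1 mat"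
  assumes P: "P \<in> carrier_mat n n" and p: "p permutes {..<n}"
  shows "det (mat n n (\<lambda>(i, j). P $$ (p i, p j))) = det P"
proof -
  have p': "p permutes {0..<n}"
    using p by (simp add: atLeast0LessThan)
  define B where "B = mat n n (\<lambda>(i, j). P $$ (p i, j))"
  have B: "B \<in> carrier_mat n n" "transpose_mat B \<in> carrier_mat n n"
    by (auto simp: B_def)
  have p_less: "p i < n" if "i < n" for i
    using permutes_in_image[OF p] that by auto
  have "mat n n (\<lambda>(i, j). P $$ (p i, p j))
      = transpose_mat (mat n n (\<lambda>(i, j). transpose_mat B $$ (p i, j)))"
    by (rule eq_matI) (auto simp: B_def p_less)
  also have "det \<dots> = det (mat n n (\<lambda>(i, j). transpose_mat B $$ (p i, j)))"
    by (rule det_transpose) auto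
  also have "\<dots> = signof p * det (transpose_mat B)"
    by (rule det_permute_rows[OF B(2) p'])
  also have "det (transpose_mat B) = det B"
    by (rule det_transpose[OF B(1)])
  also have "det B = signof p * det P"
    unfolding B_def by (rule det_permute_rows[OF P p'])
  also have "signof p * (signof p * det P) = det P"
    by (simp add: sign_def)
  finally show ?thesis .
qed

text \<open>
  Row \<open>r\<close> encodes the relation \<open>u r + f = u (r + 1) + t r * u 0\<close>, with \<open>u n\<close> read as \<open>0\<close>; row
  \<open>0\<close> encodes \<open>u 0 + f = u 1\<close>.  For \<open>n = 1\<close> the matrix is \<open>(-1)\<close>.
\<close>

definition cyclic_RF :: "nat \<Rightarrow> (nat \<Rightarrow> int) \<Rightarrow> int mat" where
  "cyclic_RF n t = mat n n (\<lambda>(r, c).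
     if c = r then -1 else if c = Suc r then 1 else if c = 0 then t r else 0)"

lemma cyclic_RF_carrier: "cyclic_RF n t \<in> carrier_mat n n"
  by (simp add: cyclic_RF_def)

text \<open>
  The convention \<open>v n = 0\<close> lets the last row, which has no superdiagonal entry, follow the same
  formula as the others.
\<close>

lemma cyclic_RF_row:
  assumes "r < n" "v n = 0"
  shows "(\<Sum>c<n. cyclic_RF n t $$ (r, c) * v c)
       = (if r = 0 then 0 else t r * v 0) - v r + v (Suc r)"
proof -
  have "(\<Sum>c<n. cyclic_RF n t $$ (r, c) * v c)
      = (\<Sum>c<n. (if c = r then - v r else 0) + (if c = Suc r then v (Suc r) else 0)
              + (if c = 0 then (if r = 0 then 0 else t r * v 0) else 0))"
    using assms by (intro sum.cong) (auto simp: cyclic_RF_def)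
  also have "\<dots> = - v r + (if Suc r < n then v (Suc r) else 0)
      + (if r = 0 then 0 else t r * v 0)"
    using assms by (simp add: sum.distrib)
  also have "(if Suc r < n then v (Suc r) else 0) = v (Suc r)"
    using assms by (auto simp: not_less dest: le_antisym)
  finally show ?thesis by simp
qed

text \<open>
  Some integer vector \<open>v\<close> with \<open>v 0 = n\<close> is mapped by the matrix to \<open>n * f\<close> times the first unit
  vector.  Replacing the first column of the identity by \<open>v\<close> gives a lower triangular \<open>M\<close> of
  determinant \<open>n\<close> such that the product with \<open>M\<close> is upper triangular with diagonal
  \<open>n * f, -1, \<dots>, -1\<close>; now cancel \<open>n\<close>.
\<close>

lemma det_cyclic_RF:
  assumes n: "n > 0" and u0: "u 0 = int n" and un: "u n = 0"
    and rows: "\<And>r. r < n \<Longrightarrow> (\<Sum>c<n. cyclic_RF n t $$ (r, c) * u c) = f"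
  shows "det (cyclic_RF n t) = (-1) ^ (n + 1) * f"
proof -
  let ?P = "cyclic_RF n t"
  \<comment> \<open>The rows send \<open>u\<close> to the constant vector \<open>f\<close>.  They send the vector with entries \<open>n - c\<close> for
      \<open>c > 0\<close> and entry \<open>0\<close> for \<open>c = 0\<close> to \<open>-1\<close> in each row but the first, and to \<open>n - 1\<close> there.
      Adding \<open>f\<close> times the second vector to \<open>u\<close> therefore clears all rows but the first.\<close>
  define v where "v c = (if c = 0 then int n else u c + f * (int n - int c))" for c
  have vn: "v n = 0"
    using n un by (simp add: v_def)
  define M where "M = mat n n (\<lambda>(r, c). if c = 0 then v r else if r = c then 1 else 0)"
  have M: "M \<in> carrier_mat n n"
    by (simp add: M_def)
  have PM: "?P * M \<in> carrier_mat n n"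
    using cyclic_RF_carrier M by (rule mult_carrier_mat)
  have entry: "(?P * M) $$ (r, c) = (if c = 0 then if r = 0 then f * int n else 0 else ?P $$ (r, c))"
    if r: "r < n" and c: "c < n" for r c
  proof (cases "c = 0")
    case True
    have "(?P * M) $$ (r, c) = (\<Sum>k<n. ?P $$ (r, k) * v k)"
      using r c True cyclic_RF_carrier[of n t] M
      by (auto simp: scalar_prod_def M_def atLeast0LessThan cyclic_RF_def intro!: sum.cong)
    also have "\<dots> = (if r = 0 then 0 else t r * v 0) - v r + v (Suc r)"
      by (rule cyclic_RF_row[of r n v t, OF r vn])
    also have "\<dots> = (if r = 0 then f * int n else 0)"
      using rows[OF r] cyclic_RF_row[of r n u t, OF r un] u0
      by (auto simp: v_def algebra_simps split: if_splits)
    finally show ?thesis using True by simp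
  next
    case False
    have "(?P * M) $$ (r, c) = (\<Sum>k<n. ?P $$ (r, k) * (if k = c then 1 else 0))"
      using r c False cyclic_RF_carrier[of n t] M
      by (auto simp: scalar_prod_def M_def atLeast0LessThan cyclic_RF_def intro!: sum.cong)
    also have "\<dots> = ?P $$ (r, c)"
      using c by (simp add: if_distrib[where f = "\<lambda>x. _ * x"] cong: if_cong)
    finally show ?thesis using False by simp
  qed
  obtain k where k: "n = Suc k"
    using n by (cases n) auto
  have prod_diag: "prod_list (diag_mat A) = A $$ (0, 0) * (\<Prod>i<k. A $$ (Suc i, Suc i))"
    if "A \<in> carrier_mat n n" for A :: "int mat"
  proof -
    have "prod_list (diag_mat A) = (\<Prod>i<n. A $$ (i, i))"
      unfolding prod.list_conv_set_nth using that
      by (intro prod.cong) (auto simp: diag_mat_def)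
    also have "\<dots> = (\<Prod>i<Suc k. A $$ (i, i))"
      using k by simp
    also have "\<dots> = A $$ (0, 0) * (\<Prod>i<k. A $$ (Suc i, Suc i))"
      by (rule prod.lessThan_Suc_shift)
    finally show ?thesis .
  qed
  have "det (?P * M) = prod_list (diag_mat (?P * M))"
  proof (rule det_upper_triangular[OF _ PM], rule upper_triangularI)
    fix i j assume ij: "j < i" "i < dim_row (?P * M)"
    then have "i < n" "j < n" using PM by auto
    with ij show "(?P * M) $$ (i, j) = 0"
      by (auto simp: entry) (auto simp: cyclic_RF_def)
  qed
  also have "\<dots> = f * int n * (-1) ^ k"
  proof -
    have "(?P * M) $$ (0, 0) = f * int n"
      using n by (simp add: entry)
    moreover have "(?P * M) $$ (Suc i, Suc i) = - 1" if "i < k" for i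
      using that k entry[of "Suc i" "Suc i"] by (simp add: cyclic_RF_def)
    ultimately show ?thesis
      unfolding prod_diag[OF PM] by simp
  qed
  finally have 1: "det (?P * M) = f * int n * (-1) ^ k" .
  have "det M = prod_list (diag_mat M)"
    by (rule det_lower_triangular[OF _ M]) (auto simp: M_def)
  also have "\<dots> = int n"
    unfolding prod_diag[OF M] using k by (simp add: M_def v_def)
  finally have "det ?P * int n = f * int n * (-1) ^ k"
    using 1 det_mult[OF cyclic_RF_carrier M, of t] by simp
  then have "int n * det ?P = int n * (f * (-1) ^ k)"
    by (simp add: mult_ac)
  then have "det ?P = f * (-1) ^ k"
    using n by (simp del: of_nat_Suc)
  then show ?thesis
    using k by (simp add: mult.commute)
qed

lemma sum_lessThan_4: "(\<Sum>j<4. g j) = g 0 + g 1 + g 2 + g (3 :: nat)"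
  by (simp add: eval_nat_numeral)

text \<open>
  This will serve for the generators in the order \<open>4, f + 3, f + 4, f + 1\<close> of their residues
  \<open>0, 1, 2, 3\<close> modulo \<open>4\<close>, where \<open>f = 4 * k + 2\<close>.  The third row writes \<open>f + (f + 4)\<close> as
  \<open>(f + 3) + (f + 1)\<close>; it is also \<open>(2 * k + 2) * 4\<close>, but a row made from that relation would give
  determinant \<open>0\<close>.
\<close>

definition quartic_RF :: "int \<Rightarrow> int mat" where
  "quartic_RF k = mat 4 4 (\<lambda>(i, j).
     [[-1, 0, 1, 0], [k + 1, -1, 0, 1], [0, 1, -1, 1], [k, 1, 0, -1]] ! i ! j)"

lemma mat_delete_mat:
  "mat_delete (mat (Suc m) (Suc n) g) i j
     = mat m n (\<lambda>(a, b). g (insert_index i a, insert_index j b))"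
  by (rule eq_matI) (auto simp: mat_delete_def insert_index_def)

lemma det_mat_Suc:
  "det (mat (Suc n) (Suc n) g)
     = (\<Sum>i<Suc n. (-1) ^ i * g (i, 0) * det (mat n n (\<lambda>(a, b). g (insert_index i a, Suc b))))"
  by (subst laplace_expansion_column[of _ "Suc n" 0])
     (auto simp: cofactor_def mat_delete_mat insert_index_def
           simp del: sum.lessThan_Suc intro!: sum.cong)

lemma det_quartic_RF: "det (quartic_RF k) = - (4 * k + 2)"
  unfolding quartic_RF_def
  by (simp add: det_mat_Suc eval_nat_numeral insert_index_def algebra_simps)

section \<open>Enumerating the generators in another order\<close>

text \<open>
  An RF-matrix refers to the generators in increasing order.  Reading a matrix \<open>P\<close>, written for
  an arbitrary enumeration \<open>u\<close>, in increasing order amounts to conjugating it by a permutation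
  matrix, so that any order may be used to find an RF-matrix of given determinant.
\<close>

lemma RF_matrix_of_enumeration:
  assumes u: "bij_betw u {..<n} (minimal_generators S)"
    and f: "pseudo_frobenius S f"
    and P: "P \<in> carrier_mat n n"
    and diag: "\<And>r. r < n \<Longrightarrow> P $$ (r, r) = -1"
    and nonneg: "\<And>r c. r < n \<Longrightarrow> c < n \<Longrightarrow> r \<noteq> c \<Longrightarrow> 0 \<le> P $$ (r, c)"
    and rows: "\<And>r. r < n \<Longrightarrow> (\<Sum>c<n. P $$ (r, c) * int (u c)) = f"
  shows "embedding_dimension S = n" "\<exists>A. RF_matrix S f A \<and> det A = det P"
proof -
  let ?G = "minimal_generators S"
  show e: "embedding_dimension S = n"
    using bij_betw_same_card[OF u] by (simp add: embedding_dimension_def)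
  have "finite ?G"
    using bij_betw_finite[OF u] by simp
  then have g: "bij_betw (min_gen S) {..<n} ?G"
    using bij_betw_nth[of "sorted_list_of_set ?G" "{..<n}" ?G] e
    by (simp add: min_gen_def[abs_def] embedding_dimension_def)
  define p where "p i = (if i < n then the_inv_into {..<n} u (min_gen S i) else i)" for i
  have "bij_betw (the_inv_into {..<n} u \<circ> min_gen S) {..<n} {..<n}"
    using g bij_betw_the_inv_into[OF u] by (rule bij_betw_trans)
  then have p_bij: "bij_betw p {..<n} {..<n}"
    by (rule bij_betw_cong[THEN iffD1, rotated]) (simp add: p_def)
  then have p: "p permutes {..<n}"
    by (rule bij_imp_permutes) (simp add: p_def)
  have p_less: "p i < n" if "i < n" for i
    using permutes_in_image[OF p] that by auto
  have up: "u (p i) = min_gen S i" if "i < n" for i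
    using f_the_inv_into_f_bij_betw[OF u] bij_betwE[OF g] that by (simp add: p_def)
  define A where "A = mat n n (\<lambda>(i, j). P $$ (p i, p j))"
  have "(\<Sum>j<n. A $$ (i, j) * int (min_gen S j)) = f" if i: "i < n" for i
  proof -
    have "(\<Sum>j<n. A $$ (i, j) * int (min_gen S j)) = (\<Sum>j<n. P $$ (p i, p j) * int (u (p j)))"
      using i by (intro sum.cong) (auto simp: A_def up)
    also have "\<dots> = (\<Sum>c<n. P $$ (p i, c) * int (u c))"
      by (rule sum.reindex_bij_betw[OF p_bij])
    also have "\<dots> = f"
      by (rule rows[OF p_less[OF i]])
    finally show ?thesis .
  qed
  moreover have "p i \<noteq> p j" if "i \<noteq> j" for i j
    using permutes_inj[OF p] that by (auto dest: injD)
  ultimately have "RF_matrix S f A"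
    using f e by (auto simp: RF_matrix_def A_def diag nonneg p_less)
  moreover have "det A = det P"
    unfolding A_def by (rule det_permute_simultaneously[OF P p])
  ultimately show "\<exists>A. RF_matrix S f A \<and> det A = det P"
    by blast
qed

section \<open>Generators of a submonoid\<close>

definition irreducibles :: "nat set \<Rightarrow> nat set" where
  "irreducibles S = {x \<in> S. x \<noteq> 0 \<and> (\<forall>a\<in>S. \<forall>b\<in>S. x = a + b \<longrightarrow> a = 0 \<or> b = 0)}"

lemma additive_submonoid_hull: "additive_submonoid (additive_submonoid hull G)"
  by (rule hull_in) (auto simp: additive_submonoid_def)

lemma additive_submonoid_mult:
  assumes "additive_submonoid M" "x \<in> M"
  shows "k * x \<in> M"
  using assms by (induction k) (auto simp: additive_submonoid_def)

text \<open>
  Removing an irreducible element from a submonoid leaves a submonoid, which would contain every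
  generating set that misses that element.
\<close>

lemma irreducibles_subset_generators:
  assumes "additive_submonoid hull G = S"
  shows "irreducibles S \<subseteq> G"
proof
  fix x assume x: "x \<in> irreducibles S"
  show "x \<in> G"
  proof (rule ccontr)
    assume "x \<notin> G"
    have S: "additive_submonoid S" "G \<subseteq> S"
      using additive_submonoid_hull[of G] hull_subset[of G additive_submonoid] assms by auto
    have "additive_submonoid (S - {x})"
    proof -
      have "a + b \<noteq> x" if "a \<in> S - {x}" "b \<in> S - {x}" for a b
        using that x unfolding irreducibles_def by fastforce
      then show ?thesis
        using S(1) x by (auto simp: additive_submonoid_def irreducibles_def)
    qed
    then have "S \<subseteq> S - {x}"
      using hull_minimal[of G "S - {x}" additive_submonoid] S(2) \<open>x \<notin> G\<close> assms by blast
    then show False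
      using x by (auto simp: irreducibles_def)
  qed
qed

text \<open>
  A generating set that consists of irreducibles is contained in every other generating set, so
  it is the only minimal one.
\<close>

lemma minimal_generators_eqI:
  assumes gen: "additive_submonoid hull G = S" and irr: "G \<subseteq> irreducibles S"
  shows "minimal_generators S = G"
proof -
  have "is_minimal_generating_set S G"
    using gen irr irreducibles_subset_generators unfolding is_minimal_generating_set_def by blast
  moreover have "H = G" if "is_minimal_generating_set S H" for H
  proof (rule ccontr)
    assume "H \<noteq> G"
    have "G \<subseteq> H"
      using that irr irreducibles_subset_generators[of H S]
      by (auto simp: is_minimal_generating_set_def)
    with \<open>H \<noteq> G\<close> have "G \<subset> H" by blast
    then show False
      using that gen by (auto simp: is_minimal_generating_set_def)
  qed
  ultimately show ?thesis
    unfolding minimal_generators_def by (rule the_equality)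
qed

section \<open>Numerical semigroups and their Apery elements\<close>

text \<open>Residue classes are given by integer representatives.\<close>

definition apery :: "nat set \<Rightarrow> int \<Rightarrow> nat" where
  "apery S x = (LEAST s. s \<in> S \<and> [int s = x] (mod int (multiplicity_of S)))"

context
  fixes S :: "nat set" and m :: nat and f :: int
  assumes num: "numerical_semigroup S"
    and m_def: "m = multiplicity_of S" and f_def: "f = frobenius_number S"
begin

lemma submonoid: "additive_submonoid S"
  using num by (simp add: numerical_semigroup_def)

lemma zero_in: "0 \<in> S"
  using submonoid by (simp add: additive_submonoid_def)

lemma add_in: "a \<in> S \<Longrightarrow> b \<in> S \<Longrightarrow> a + b \<in> S"
  using submonoid by (simp add: additive_submonoid_def)

lemma eventually_in: "\<exists>N. \<forall>s\<ge>N. s \<in> S"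
proof -
  have "finite (- S)"
    using num by (simp add: numerical_semigroup_def)
  then obtain N where "\<forall>s\<in>-S. s < N"
    using finite_nat_set_iff_bounded by blast
  then show ?thesis
    by (metis ComplI leD)
qed

lemma multiplicity_in: "m \<in> S" "m > 0"
proof -
  obtain N where "\<forall>s\<ge>N. s \<in> S" using eventually_in ..
  then have "Suc N \<in> S \<and> Suc N \<noteq> 0" by simp
  then have "m \<in> S \<and> m \<noteq> 0"
    unfolding m_def multiplicity_of_def by (rule LeastI)
  then show "m \<in> S" "m > 0" by auto
qed

lemma multiplicity_le: "s \<in> S \<Longrightarrow> s \<noteq> 0 \<Longrightarrow> m \<le> s"
  unfolding m_def multiplicity_of_def by (rule Least_le) simp

lemma add_multiple_in: "s \<in> S \<Longrightarrow> s + k * m \<in> S"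
  by (simp add: add_in additive_submonoid_mult[OF submonoid multiplicity_in(1)])

lemma frobenius:
  shows frobenius_notin: "f \<notin> int ` S"
    and frobenius_less_in: "f < int s \<Longrightarrow> s \<in> S"
    and frobenius_ge: "- 1 \<le> f"
proof -
  obtain N where N: "\<forall>s\<ge>N. s \<in> S" using eventually_in ..
  define Z where "Z = {- 1..<int N} - int ` S"
  have Z: "finite Z" "Z \<noteq> {}"
  proof -
    have "- 1 \<in> Z" by (auto simp: Z_def)
    then show "Z \<noteq> {}" by blast
  qed (simp add: Z_def)
  have max: "z \<le> Max Z" if z: "z \<notin> int ` S" for z
  proof (cases "z < 0")
    case True
    have "- 1 \<le> Max Z"
      using Z(1) by (rule Max_ge) (auto simp: Z_def)
    with True show ?thesis by simp
  next
    case False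
    then have "\<not> N \<le> nat z"
      using z N by (force simp: image_iff)
    with False z have "z \<in> Z" by (auto simp: Z_def)
    with Z(1) show ?thesis by simp
  qed
  have "Max Z \<in> Z" using Z by (rule Max_in)
  have "f = Max Z"
    unfolding f_def frobenius_number_def
    by (rule Greatest_equality) (use max \<open>Max Z \<in> Z\<close> in \<open>auto simp: Z_def\<close>)
  then show "f \<notin> int ` S" "- 1 \<le> f"
    using \<open>Max Z \<in> Z\<close> by (auto simp: Z_def)
  show "s \<in> S" if "f < int s"
  proof (rule ccontr)
    assume "s \<notin> S"
    then have "int s \<notin> int ` S" by auto
    then show False
      using max[of "int s"] that \<open>f = Max Z\<close> by simp
  qed
qed

lemma frobenius_pseudo: "pseudo_frobenius S f"
proof -
  have "f + int s \<in> int ` S" if "s \<in> S" "s \<noteq> 0" for s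
  proof -
    have "nat (f + int s) \<in> S" "f + int s \<ge> 0"
      using that frobenius_ge by (auto intro: frobenius_less_in)
    then show ?thesis
      by (metis imageI int_nat_eq)
  qed
  then show ?thesis
    using frobenius_notin by (simp add: pseudo_frobenius_def)
qed

lemma apery:
  shows apery_in: "apery S x \<in> S" 
    and apery_cong: "[int (apery S x) = x] (mod int m)"
proof -
  obtain N where N: "\<forall>s\<ge>N. s \<in> S" using eventually_in ..
  have m: "int m > 0" using multiplicity_in by simp
  define s where "s = nat (x mod int m) + N * m"
  have "int s = x mod int m + int N * int m"
    using m by (simp add: s_def)
  then have "[int s = x] (mod int m)"
    by (simp add: cong_def)
  moreover have "N \<le> s"
    using multiplicity_in by (simp add: s_def trans_le_add2)
  ultimately have "s \<in> S \<and> [int s = x] (mod int (multiplicity_of S))"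
    using N by (simp add: m_def)
  then have "apery S x \<in> S \<and> [int (apery S x) = x] (mod int (multiplicity_of S))"
    unfolding apery_def by (rule LeastI)
  then show "apery S x \<in> S" "[int (apery S x) = x] (mod int m)"
    by (auto simp: m_def)
qed

lemma apery_le: "s \<in> S \<Longrightarrow> [int s = x] (mod int m) \<Longrightarrow> apery S x \<le> s"
  unfolding apery_def by (rule Least_le) (simp add: m_def)

lemma apery_eqI:
  assumes "s \<in> S" "[int s = x] (mod int m)"
    and "\<And>s'. s' \<in> S \<Longrightarrow> [int s' = x] (mod int m) \<Longrightarrow> s \<le> s'"
  shows "apery S x = s"
  using assms apery_in apery_cong apery_le by (meson order_antisym)

lemma apery_cong_eq: "[x = y] (mod int m) \<Longrightarrow> apery S x = apery S y"
  by (simp add: apery_def cong_def m_def)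

lemma apery_eq_0: "int m dvd x \<Longrightarrow> apery S x = 0"
  using apery_le[of 0 x] zero_in by (auto simp: cong_def dvd_eq_mod_eq_0)

lemma apery_pos:
  assumes "\<not> int m dvd x"
  shows "apery S x \<noteq> 0"
  using apery_cong[of x] assms by (metis cong_def dvd_eq_mod_eq_0 mod_0 of_nat_0)

lemma apery_decomposition:
  assumes "s \<in> S" "[int s = x] (mod int m)"
  obtains k where "s = apery S x + k * m"
proof -
  have "[apery S x = s] (mod m)"
    using assms(2) apery_cong[of x] by (metis cong_int_iff cong_sym cong_trans)
  then show ?thesis
    using that cong_le_nat[OF apery_le[OF assms], of m] cong_sym[of "apery S x" s m]
    by (auto simp: add.commute)
qed

lemma apery_above_frobenius:
  assumes d: "d > 0" and x: "[f + d = x] (mod int m)"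
    and least: "\<And>s. s \<in> S \<Longrightarrow> [int s = x] (mod int m) \<Longrightarrow> f + d \<le> int s"
  shows "int (apery S x) = f + d"
proof -
  have nonneg: "f + d \<ge> 0"
    using frobenius_ge d by linarith
  then have "apery S x = nat (f + d)"
    using d x least by (intro apery_eqI) (auto intro: frobenius_less_in simp: nat_le_iff)
  with nonneg show ?thesis by simp
qed

text \<open>
  Subtracting \<open>m\<close> from \<open>f + m\<close> leads out of the semigroup, and then so does subtracting any
  larger multiple of \<open>m\<close>.
\<close>

lemma apery_frobenius: "int (apery S f) = f + int m"
proof (rule apery_above_frobenius)
  fix s assume s: "s \<in> S" "[int s = f] (mod int m)"
  show "f + int m \<le> int s"
  proof (rule ccontr)
    assume less: "\<not> f + int m \<le> int s"
    obtain q where q: "f - int s = int m * q"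
      using s(2) by (metis cong_iff_dvd_diff cong_sym dvdE)
    have "int m * (q + 1) > 0"
      using less q by (simp add: algebra_simps)
    then have "q \<ge> 0"
      using multiplicity_in by (simp add: zero_less_mult_iff)
    then have "f = int (s + nat q * m)"
      using q by (simp add: algebra_simps)
    with add_multiple_in[OF s(1)] frobenius_notin show False by blast
  qed
qed (use multiplicity_in in \<open>simp_all add: cong_def\<close>)

lemma frobenius_not_dvd:
  assumes "m \<noteq> 1"
  shows "\<not> int m dvd f"
  using apery_frobenius apery_eq_0[of f] frobenius_ge multiplicity_in assms by auto

section \<open>Arf semigroups\<close>

context
  assumes arf: "Arf S"
begin

lemma arf_sub:
  assumes "r \<in> S" "a \<in> S" "b \<in> S" "r \<le> a" "r \<le> b"
  shows "a + b - r \<in> S"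
  using arf assms unfolding Arf_def by (metis add.commute linear)

text \<open>
  If \<open>apery S x = a + b\<close> with nonzero \<open>a\<close>, \<open>b\<close>, then the Arf property applied to \<open>m \<le> a, b\<close> yields the
  smaller element \<open>a + b - m\<close> of the same class.
\<close>

lemma apery_irreducible:
  assumes "\<not> int m dvd x"
  shows "apery S x \<in> irreducibles S"
proof -
  have False if ab: "a \<in> S" "b \<in> S" "a \<noteq> 0" "b \<noteq> 0" and sum: "apery S x = a + b" for a b
  proof -
    have le: "m \<le> a" "m \<le> b"
      using ab multiplicity_le by auto
    then have "a + b - m \<in> S"
      using arf_sub ab multiplicity_in by blast
    moreover have "[int (a + b - m) = x] (mod int m)"
      using apery_cong[of x] le unfolding sum
      by (simp add: of_nat_diff cong_def)
    ultimately show False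
      using apery_le[of "a + b - m" x] sum le multiplicity_in by simp
  qed
  then show ?thesis
    using apery_in apery_pos[OF assms] by (auto simp: irreducibles_def)
qed

lemma multiplicity_irreducible: "m \<in> irreducibles S"
  using multiplicity_in multiplicity_le by (fastforce simp: irreducibles_def)

text \<open>
  Every \<open>s\<close> in the semigroup is the Apery element of its class plus a multiple of \<open>m\<close>.  Thus \<open>m\<close>
  and the nonzero Apery elements generate, and they are irreducible.  The function \<open>x\<close> fixes the
  order in which they are listed; the place of the zero class, whose Apery element is \<open>0\<close>, is
  taken by \<open>m\<close>.
\<close>

lemma bij_betw_minimal_generators:
  assumes x: "inj_on (\<lambda>r. x r mod int m) {..<m}" "x 0 = 0"
  shows "bij_betw (\<lambda>r. if r = 0 then m else apery S (x r)) {..<m} (minimal_generators S)"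
    (is "bij_betw ?u _ _")
proof -
  have not_dvd: "\<not> int m dvd x r" if "0 < r" "r < m" for r
    using inj_onD[OF x(1), of r 0] that x(2) by auto
  have u_cong: "[int (?u r) = x r] (mod int m)" for r
    using apery_cong x(2) by (auto simp: cong_def)
  have "(\<lambda>r. x r mod int m) ` {..<m} = {0..<int m}"
    by (rule card_subset_eq) (use multiplicity_in in \<open>auto simp: card_image[OF x(1)]\<close>)
  have surj: "\<exists>r<m. y mod int m = x r mod int m" for y
  proof -
    have "y mod int m \<in> {0..<int m}"
      using multiplicity_in by simp
    also have "\<dots> = (\<lambda>r. x r mod int m) ` {..<m}" by (rule sym) fact
    finally show ?thesis by auto
  qed
  define G where "G = ?u ` {..<m}"
  have irr: "G \<subseteq> irreducibles S"
    using multiplicity_irreducible apery_irreducible not_dvd by (auto simp: G_def)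
  have mG: "m \<in> G"
    unfolding G_def using multiplicity_in by (intro image_eqI[of _ _ 0]) auto
  let ?H = "additive_submonoid hull G"
  have "?H = S"
  proof
    show "?H \<subseteq> S"
      using irr submonoid by (intro hull_minimal) (auto simp: irreducibles_def)
    show "S \<subseteq> ?H"
    proof
      fix s assume s: "s \<in> S"
      obtain r where r: "r < m" "[int s = x r] (mod int m)"
        using surj[of "int s"] by (auto simp: cong_def)
      obtain k where k: "s = apery S (x r) + k * m"
        using apery_decomposition[OF s r(2)] .
      have "k * m \<in> ?H"
        by (rule additive_submonoid_mult[OF additive_submonoid_hull hull_inc[OF mG]])
      moreover have "apery S (x r) \<in> ?H"
      proof (cases "r = 0")
        case True
        then show ?thesis
          using additive_submonoid_hull[of G] x(2) apery_eq_0
          by (simp add: additive_submonoid_def)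
      next
        case False
        then show ?thesis
          using r(1) by (intro hull_inc) (auto simp: G_def)
      qed
      ultimately show "s \<in> ?H"
        using additive_submonoid_hull[of G] k by (simp add: additive_submonoid_def)
    qed
  qed
  then have "minimal_generators S = G"
    using irr by (rule minimal_generators_eqI)
  moreover have "inj_on ?u {..<m}"
  proof (rule inj_onI)
    fix r r' assume "r \<in> {..<m}" "r' \<in> {..<m}" "?u r = ?u r'"
    have "x r mod int m = int (?u r) mod int m"
      using u_cong[of r] by (simp only: cong_def)
    also have "\<dots> = int (?u r') mod int m"
      by (rule arg_cong) fact
    also have "\<dots> = x r' mod int m"
      using u_cong[of r'] by (simp only: cong_def)
    finally show "r = r'"
      using inj_onD[OF x(1)] \<open>r \<in> {..<m}\<close> \<open>r' \<in> {..<m}\<close> by blast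
  qed
  ultimately show ?thesis
    by (auto simp: bij_betw_def G_def)
qed

text \<open>
  Adding \<open>f\<close> moves each generator to the class of the next one in the list \<open>m, w f, w (2f), \<dots>\<close>, and
  the walk \<open>r \<mapsto> r f\<close> meets all classes before it returns to \<open>0\<close>.
\<close>

lemma RF_matrix_coprime:
  assumes "coprime f (int m)"
  shows "\<exists>A. RF_matrix S f A \<and> det A = (-1) ^ (embedding_dimension S + 1) * f"
proof -
  define w where "w r = apery S (int r * f)" for r
  define u where "u r = (if r = 0 then m else w r)" for r
  have inj: "inj_on (\<lambda>r. (int r * f) mod int m) {..<m}"
  proof (rule inj_onI)
    fix r r' assume r: "r \<in> {..<m}" "r' \<in> {..<m}" 
      and "(int r * f) mod int m = (int r' * f) mod int m"
    then have "[int r = int r'] (mod int m)"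
      using assms by (simp add: cong_mult_rcancel flip: cong_def)
    then show "r = r'"
      using r by (simp add: cong_int_iff cong_def)
  qed
  have u_bij: "bij_betw u {..<m} (minimal_generators S)"
    using bij_betw_minimal_generators[OF inj] unfolding u_def[abs_def] w_def by simp
  have w_m: "w m = 0"
    by (simp add: w_def apery_eq_0)
  have w_1: "int (w 1) = f + int m"
    by (simp add: w_def apery_frobenius)
  have "\<exists>t. int (w r) + f = int (w (Suc r)) + int t * int m" if r: "0 < r" "r < m" for r
  proof -
    have "\<not> int m dvd int r * f"
      using inj_onD[OF inj, of r 0] r by auto
    then have "w r \<noteq> 0"
      by (simp add: w_def apery_pos)
    define s where "s = nat (int (w r) + f)"
    have s: "int s = int (w r) + f"
      using \<open>w r \<noteq> 0\<close> frobenius_ge by (simp add: s_def)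
    have "s \<in> S"
      using \<open>w r \<noteq> 0\<close> s by (intro frobenius_less_in) simp
    moreover have "[int s = int (Suc r) * f] (mod int m)"
      unfolding s using cong_add[OF apery_cong cong_refl, of "int r * f" f]
      by (simp add: w_def algebra_simps)
    ultimately obtain t where "s = w (Suc r) + t * m"
      unfolding w_def by (rule apery_decomposition)
    with s show ?thesis by (metis of_nat_add of_nat_mult)
  qed
  then obtain t where t: "\<And>r. 0 < r \<Longrightarrow> r < m \<Longrightarrow> int (w r) + f = int (w (Suc r)) + int (t r) * int m"
    by metis
  let ?P = "cyclic_RF m (\<lambda>r. int (t r))"
  \<comment> \<open>The class of \<open>m * f\<close> is that of \<open>0\<close>, so the relation in the last row closes with \<open>w m = 0\<close>
      in place of a further generator.\<close>
  define v where "v r = (if r = m then 0 else int (u r))" for r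
  have vn: "v m = 0" by (simp add: v_def)
  have v0: "v 0 = int m" using multiplicity_in by (simp add: v_def u_def)
  have v_Suc: "v (Suc r) = int (w (Suc r))" for r
    using w_m by (simp add: v_def u_def)
  have rows: "(\<Sum>c<m. ?P $$ (r, c) * v c) = f" if r: "r < m" for r
  proof -
    have "(\<Sum>c<m. ?P $$ (r, c) * v c)
        = (if r = 0 then 0 else int (t r) * v 0) - v r + v (Suc r)"
      by (rule cyclic_RF_row[of r m v, OF r vn])
    also have "\<dots> = f"
    proof (cases r)
      case 0
      then show ?thesis
        using v_Suc[of 0] v0 w_1 by simp
    next
      case (Suc q)
      then show ?thesis
        using v_Suc[of q] v_Suc[of r] v0 t[of r] r by (simp add: algebra_simps)
    qed
    finally show ?thesis .
  qed
  have "(\<Sum>c<m. ?P $$ (r, c) * int (u c)) = f" if r: "r < m" for r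
    unfolding rows[OF r, symmetric] by (rule sum.cong) (auto simp: v_def)
  then have "embedding_dimension S = m \<and> (\<exists>A. RF_matrix S f A \<and> det A = det ?P)"
    using RF_matrix_of_enumeration[OF u_bij frobenius_pseudo cyclic_RF_carrier, of "\<lambda>r. int (t r)"]
    by (simp add: cyclic_RF_def)
  moreover have "det ?P = (-1) ^ (m + 1) * f"
    using multiplicity_in(2) v0 vn rows by (rule det_cyclic_RF)
  ultimately show ?thesis by auto
qed

text \<open>
  Adding \<open>f\<close> now only exchanges classes in pairs, so the previous construction is unavailable.
  Instead all the generators can be computed: doubling an odd element and subtracting a
  multiple of \<open>4\<close>, as the Arf property allows, gives an element congruent to \<open>2\<close>, which is at
  least \<open>w 2 = f + 4\<close>.  This bounds the odd elements from below so strongly that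
  \<open>w 1 = f + 3\<close> and \<open>w 3 = f + 1\<close>.
\<close>

lemma RF_matrix_quartic:
  assumes m: "m = 4" and f: "f mod 4 = 2"
  shows "\<exists>A. RF_matrix S f A \<and> det A = (-1) ^ (embedding_dimension S + 1) * f"
proof -
  define k where "k = f div 4"
  have fk: "f = 4 * k + 2"
    using f by (simp add: k_def) presburger
  have k: "k \<ge> 0"
    using frobenius_ge fk by simp
  define u where "u r = (if r = 0 then m else apery S (int r))" for r
  have u_bij: "bij_betw u {..<4} (minimal_generators S)"
    using bij_betw_minimal_generators[of int] m
    by (simp add: u_def[abs_def] inj_on_def flip: of_nat_mod)
  have "[2 = f] (mod int m)"
    using m f by (simp add: cong_def)
  then have w2: "int (apery S 2) = f + 4"
    using apery_frobenius m apery_cong_eq by fastforce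
  have double: "f + 4 \<le> 2 * int s - 4 * b" if s: "s \<in> S" "int s = 4 * b + c" "c \<in> {1, 3}" for s b c
  proof -
    have b: "b \<ge> 0" using s(2,3) by auto
    have "nat b * m \<in> S"
      using additive_submonoid_mult[OF submonoid multiplicity_in(1)] .
    moreover have "nat b * m \<le> s"
      using s(2,3) m b by auto
    ultimately have "s + s - nat b * m \<in> S"
      using arf_sub s(1) by blast
    moreover have eq: "int (s + s - nat b * m) = 2 * int s - 4 * b"
      using \<open>nat b * m \<le> s\<close> b m by (simp add: of_nat_diff)
    moreover have "[2 * int s - 4 * b = 2] (mod int m)"
      using s(2,3) m by (auto simp: cong_def)
    ultimately have "apery S 2 \<le> s + s - nat b * m"
      by (intro apery_le) auto
    then show ?thesis
      using w2 eq by linarith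
  qed
  have w1: "int (apery S 1) = f + 3"
  proof (rule apery_above_frobenius)
    show "[f + 3 = 1] (mod int m)"
      unfolding cong_def m fk by simp
    fix s assume s: "s \<in> S" "[int s = 1] (mod int m)"
    define b where "b = int s div 4"
    have sb: "int s = 4 * b + 1"
      using s(2) m by (simp add: cong_def b_def) presburger
    have "f + 4 \<le> 2 * int s - 4 * b"
      using double[OF s(1) sb] by simp
    then show "f + 3 \<le> int s"
      using sb fk by presburger
  qed simp
  have w3: "int (apery S 3) = f + 1"
  proof (rule apery_above_frobenius)
    show "[f + 1 = 3] (mod int m)"
      unfolding cong_def m fk by simp
    fix s assume s: "s \<in> S" "[int s = 3] (mod int m)"
    define b where "b = int s div 4"
    have sb: "int s = 4 * b + 3"
      using s(2) m by (simp add: cong_def b_def) presburger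
    have "f + 4 \<le> 2 * int s - 4 * b"
      using double[OF s(1) sb] by simp
    then show "f + 1 \<le> int s"
      using sb fk by presburger
  qed simp
  let ?P = "quartic_RF k"
  have less_4: "r < 4 \<longleftrightarrow> r = 0 \<or> r = 1 \<or> r = 2 \<or> r = 3" for r :: nat
    by auto
  have P: "?P \<in> carrier_mat 4 4"
    by (simp add: quartic_RF_def)
  have u: "int (u 0) = 4" "int (u 1) = f + 3" "int (u 2) = f + 4" "int (u 3) = f + 1"
    using w1 w2 w3 m by (simp_all add: u_def)
  have diag: "?P $$ (r, r) = -1" if "r < 4" for r
    using that by (auto simp: less_4 quartic_RF_def)
  have nonneg: "0 \<le> ?P $$ (r, c)" if "r < 4" "c < 4" "r \<noteq> c" for r c
    using that k by (auto simp: less_4 quartic_RF_def)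
  have rows: "(\<Sum>c<4. ?P $$ (r, c) * int (u c)) = f" if "r < 4" for r
    using that unfolding less_4 sum_lessThan_4 u fk by (auto simp: quartic_RF_def)
  have "embedding_dimension S = 4 \<and> (\<exists>A. RF_matrix S f A \<and> det A = det ?P)"
    using RF_matrix_of_enumeration[OF u_bij frobenius_pseudo P diag nonneg rows] by simp
  then show ?thesis
    using fk by (auto simp: det_quartic_RF)
qed

end

end

theorem theorem5p4:
  fixes S :: "nat set"
  assumes "numerical_semigroup S"
    and "Arf S"
    and "multiplicity_of S \<le> 5 \<or> int (multiplicity_of S) dvd conductor S"
  shows "\<exists>A. RF_matrix S (frobenius_number S) A \<and>
           det A = (-1) ^ (embedding_dimension S + 1) * frobenius_number S"
proof -
  define m where "m = multiplicity_of S"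
  define f where "f = frobenius_number S"
  note ctx = assms(1) m_def f_def
  have "coprime f (int m) \<or> m = 4 \<and> f mod 4 = 2"
  proof (cases "int m dvd conductor S")
    case True
    then obtain q where "f + 1 = int m * q"
      by (auto simp: conductor_def f_def)
    then have "f * (- 1) + int m * q = 1" by simp
    then show ?thesis
      by (metis coprime_iff_invertible_int cong_iff_lin)
  next
    case False
    then have "m \<le> 5"
      using assms(3) by (simp add: m_def)
    moreover have "m > 0" by (rule multiplicity_in(2)[OF ctx])
    ultimately consider "m = 1" | "m = 4" | "m \<in> {2, 3, 5}"
      by fastforce
    then show ?thesis
    proof cases
      case 1
      then show ?thesis by simp
    next
      case 2
      then have "\<not> 4 dvd f" using frobenius_not_dvd[OF ctx] by simp
      show ?thesis
      proof (cases "even f")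
        case True
        then show ?thesis using 2 \<open>\<not> 4 dvd f\<close> by presburger
      next
        case False
        then have "coprime f (2 * 2)"
          unfolding coprime_mult_right_iff by simp
        then show ?thesis using 2 by simp
      qed
    next
      case 3
      then have "prime (int m)" by auto
      moreover have "\<not> int m dvd f" using frobenius_not_dvd[OF ctx] 3 by auto
      ultimately show ?thesis
        using prime_imp_coprime coprime_commute by blast
    qed
  qed
  then show ?thesis
    using RF_matrix_coprime[OF ctx assms(2)] RF_matrix_quartic[OF ctx assms(2)]
    unfolding f_def by blast
qed

end
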